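(* Let $t\geq 2$ be an integer. Then $b_{t+1,1}(n)\geq b_{t,1}(n)$ for all integers $n\geq 0$.
   Context: A partition of a positive integer $n$ is a finite non-increasing sequence of positive integers $\lambda=(\lambda_1,\lambda_2,\ldots,\lambda_r)$ with $\lambda_1+\cdots+\lambda_r=n$; for $n=0$ the only partition is the empty one, whose Young diagram has no boxes. The Young diagram of $\lambda$ is the left-justified array of boxes whose $i$-th row from the top has $\lambda_i$ boxes. The hook length of a box in a Young diagram is the number of boxes directly to its right (in the same row) plus the number of boxes directly below it (in the same column) plus $1$ (for the box itself). For an integer $t\geq 2$, a $t$-regular partition of $n$ is a partition of $n$ none of whose parts is divisible by $t$. For integers $t\geq 2$ and $k\geq 1$, $b_{t,k}(n)$ denotes the number of hooks of length $k$ in all the $t$-regular partitions of $n$, i.e. the sum over all $t$-regular partitions $\lambda$ of $n$ of the number of boxes in the Young diagram of $\lambda$ with hook length equal to $k$. *)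

theory Defs
  imports Main
begin

definition is_partition :: "nat list \<Rightarrow> nat \<Rightarrow> bool" where
  "is_partition xs n \<longleftrightarrow>
     sorted_wrt (\<ge>) xs \<and> (\<forall>x\<in>set xs. x > 0) \<and> sum_list xs = n"

definition regular_partitions :: "nat \<Rightarrow> nat \<Rightarrow> nat list set" where
  "regular_partitions t n = {xs. is_partition xs n \<and> (\<forall>x\<in>set xs. \<not> t dvd x)}"

(* Boxes are pairs (row, column), both counted from 0, rows from top to bottom. *)
definition young_diagram :: "nat list \<Rightarrow> (nat \<times> nat) set" where
  "young_diagram xs = {(i, j). i < length xs \<and> j < xs ! i}"

definition hook_length :: "nat list \<Rightarrow> nat \<times> nat \<Rightarrow> nat" where
  "hook_length xs = (\<lambda>(i, j).
     card {j'. j < j' \<and> (i, j') \<in> young_diagram xs} +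
     card {i'. i < i' \<and> (i', j) \<in> young_diagram xs} + 1)"

(* regular_hooks t k n is commonly written b_{t,k}(n). *)
definition regular_hooks :: "nat \<Rightarrow> nat \<Rightarrow> nat \<Rightarrow> nat" where
  "regular_hooks t k n = (\<Sum>xs\<in>regular_partitions t n.
     card {c \<in> young_diagram xs. hook_length xs c = k})"

(* The two facts below ensure that the sum and the cardinality in the definition
   of regular_hooks do not take the default value 0 of sum and card on infinite sets. *)

lemma finite_regular_partitions: "finite (regular_partitions t n)"
proof (rule finite_subset)
  have len: "length xs \<le> sum_list xs" if "\<forall>x\<in>set xs. x > 0" for xs :: "nat list"
    using that by (induction xs) auto
  show "regular_partitions t n \<subseteq> {xs. set xs \<subseteq> {..n} \<and> length xs \<le> n}"
    using len member_le_sum_list by (fastforce simp: regular_partitions_def is_partition_def)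
qed (simp add: finite_lists_length_le)

lemma finite_young_diagram: "finite (young_diagram xs)"
proof -
  have "young_diagram xs = (SIGMA i:{..<length xs}. {..<xs ! i})"
    by (auto simp: young_diagram_def)
  then show ?thesis by simp
qed

end

(* A hook of length 1 is a corner of the diagram, so b_{t,1}(n) counts pairs of a t-regular
   partition of n and a part size m occurring in it; deleting one part m gives
   b_{t,1}(n) = sum of p_t(n - m) over m in {1..n} not divisible by t, where p_t(k) is the number
   of t-regular partitions of k.  Adding a part 1 shows that p_t is nondecreasing, and Glaisher's
   identity gives p_t <= p_{t+1}.  Since p_t(n - (t+1) j) <= p_t(n - t j), omitting the multiples
   of t + 1 from the sum of all p_t(n - m) leaves at least as much as omitting those of t. *)
theory Submission
  imports Defs "HOL-Library.Multiset" "HOL-Computational_Algebra.Formal_Power_Series"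
begin

unbundle fps_syntax

subsection \<open>Partitions as multisets\<close>

definition mset_partitions :: "nat set \<Rightarrow> nat \<Rightarrow> nat multiset set" where
  "mset_partitions A n = {M. set_mset M \<subseteq> A \<and> sum_mset M = n}"

definition regular_parts :: "nat \<Rightarrow> nat set" where
  "regular_parts t = {m. 0 < m \<and> \<not> t dvd m}"

lemma sum_mset_ge_member: "x \<in># M \<Longrightarrow> x \<le> sum_mset M" for x :: nat
  by (metis le_add1 multi_member_split sum_mset.add_mset)

lemma sum_mset_ge_size: "0 \<notin># M \<Longrightarrow> size M \<le> sum_mset M" for M :: "nat multiset"
  by (induction M) (auto simp: Suc_le_eq)

text \<open>Excluding the part 0 is what bounds the number of parts by \<open>n\<close>; zeros could
  otherwise be repeated without limit.\<close>

lemma finite_mset_partitions: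
  assumes "0 \<notin> A"
  shows "finite (mset_partitions A n)"
proof (rule finite_subset)
  show "mset_partitions A n \<subseteq> mset ` {xs. set xs \<subseteq> {..n} \<and> length xs \<le> n}"
  proof
    fix M assume M: "M \<in> mset_partitions A n"
    obtain xs where xs: "M = mset xs" using ex_mset by metis
    have "0 \<notin># M" using M assms by (auto simp: mset_partitions_def)
    then have "size M \<le> n" "set_mset M \<subseteq> {..n}"
      using M sum_mset_ge_size[of M] sum_mset_ge_member[of _ M] by (auto simp: mset_partitions_def)
    then show "M \<in> mset ` {xs. set xs \<subseteq> {..n} \<and> length xs \<le> n}"
      using xs by auto
  qed
qed (simp add: finite_lists_length_le)

text \<open>With multisets a part can be added or deleted without re-sorting. No information is
  lost, since sorting a multiset and reversing recovers the non-increasing list.\<close>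

lemma bij_betw_mset_regular_partitions:
  "bij_betw mset (regular_partitions t n) (mset_partitions (regular_parts t) n)"
proof (rule bij_betwI')
  fix xs ys assume "xs \<in> regular_partitions t n" "ys \<in> regular_partitions t n"
  then have "sorted (rev xs)" "sorted (rev ys)"
    by (auto simp: regular_partitions_def is_partition_def sorted_wrt_rev)
  then show "(mset xs = mset ys) = (xs = ys)"
    by (metis mset_rev properties_for_sort rev_rev_ident)
next
  fix xs assume "xs \<in> regular_partitions t n"
  then show "mset xs \<in> mset_partitions (regular_parts t) n"
    by (auto simp: regular_partitions_def is_partition_def mset_partitions_def
        regular_parts_def sum_mset_sum_list)
next
  fix M assume M: "M \<in> mset_partitions (regular_parts t) n"
  let ?xs = "rev (sorted_list_of_multiset M)"
  have "mset ?xs = M" by simp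
  moreover have "sum_list ?xs = sum_mset M"
    by (metis \<open>mset ?xs = M\<close> sum_mset_sum_list)
  moreover have "sorted_wrt (\<ge>) ?xs"
    by (simp add: sorted_wrt_rev)
  ultimately have "?xs \<in> regular_partitions t n"
    using M by (auto simp: regular_partitions_def is_partition_def mset_partitions_def regular_parts_def)
  then show "\<exists>xs\<in>regular_partitions t n. M = mset xs"
    using \<open>mset ?xs = M\<close> by metis
qed

lemma card_mset_partitions_containing:
  assumes "m \<in> A" "m \<le> n"
  shows "card {M \<in> mset_partitions A n. m \<in># M} = card (mset_partitions A (n - m))"
proof -
  have "bij_betw (add_mset m) (mset_partitions A (n - m)) {M \<in> mset_partitions A n. m \<in># M}"
  proof (rule bij_betwI')
    fix M assume "M \<in> {M \<in> mset_partitions A n. m \<in># M}"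
    then show "\<exists>N\<in>mset_partitions A (n - m). M = add_mset m N"
      by (auto simp: mset_partitions_def dest!: multi_member_split)
  qed (use assms in \<open>auto simp: mset_partitions_def\<close>)
  then show ?thesis by (metis bij_betw_same_card)
qed

lemma card_mset_partitions_mono:
  assumes "0 \<notin> A" "1 \<in> A" "m \<le> n"
  shows "card (mset_partitions A m) \<le> card (mset_partitions A n)"
proof (rule lift_Suc_mono_le[OF _ assms(3)])
  fix k
  have "card (mset_partitions A k) = card {M \<in> mset_partitions A (Suc k). 1 \<in># M}"
    using card_mset_partitions_containing[OF assms(2), of "Suc k"] by simp
  also have "\<dots> \<le> card (mset_partitions A (Suc k))"
    by (intro card_mono finite_mset_partitions assms) auto
  finally show "card (mset_partitions A k) \<le> card (mset_partitions A (Suc k))" .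
qed

text \<open>Double counting of the pairs of a partition and a part size occurring in it. Fixing the
  size \<open>m\<close> first, one copy of \<open>m\<close> is deleted; further copies may
  remain.\<close>

lemma sum_card_set_mset_partitions:
  assumes "0 \<notin> A"
  shows "(\<Sum>M\<in>mset_partitions A n. card (set_mset M)) =
    (\<Sum>m\<in>A \<inter> {1..n}. card (mset_partitions A (n - m)))"
proof -
  have "card (set_mset M) = (\<Sum>m\<in>A \<inter> {1..n}. if m \<in># M then 1 else 0)"
    if "M \<in> mset_partitions A n" for M
  proof -
    have "set_mset M \<subseteq> A \<inter> {1..n}"
      using that assms sum_mset_ge_member[of _ M]
      by (auto simp: mset_partitions_def Suc_le_eq intro!: Nat.gr0I)
    then have "A \<inter> {1..n} \<inter> set_mset M = set_mset M" by blast
    then show ?thesis by (simp add: sum.If_cases)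
  qed
  then have "(\<Sum>M\<in>mset_partitions A n. card (set_mset M)) =
      (\<Sum>M\<in>mset_partitions A n. \<Sum>m\<in>A \<inter> {1..n}. if m \<in># M then 1 else 0)"
    by (rule sum.cong[OF refl])
  also have "\<dots> = (\<Sum>m\<in>A \<inter> {1..n}. \<Sum>M\<in>mset_partitions A n. if m \<in># M then 1 else 0)"
    by (rule sum.swap)
  also have "\<dots> = (\<Sum>m\<in>A \<inter> {1..n}. card {M \<in> mset_partitions A n. m \<in># M})"
    by (intro sum.cong refl)
      (simp add: sum.If_cases finite_mset_partitions assms Int_def)
  also have "\<dots> = (\<Sum>m\<in>A \<inter> {1..n}. card (mset_partitions A (n - m)))"
    by (intro sum.cong refl card_mset_partitions_containing) auto
  finally show ?thesis .
qed

subsection \<open>Hooks of length one\<close>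

lemma hook_length_eq_1_iff:
  "hook_length xs (i, j) = 1 \<longleftrightarrow>
    (\<forall>j'>j. (i, j') \<notin> young_diagram xs) \<and> (\<forall>i'>i. (i', j) \<notin> young_diagram xs)"
proof -
  \<comment> \<open>Finiteness matters: \<open>card\<close> is 0 on infinite sets, so only for
    finite arms and legs does cardinality 0 mean emptiness.\<close>
  have "{j'. j < j' \<and> (i, j') \<in> young_diagram xs} \<subseteq> snd ` young_diagram xs"
    "{i'. i < i' \<and> (i', j) \<in> young_diagram xs} \<subseteq> fst ` young_diagram xs"
    by force+
  then have "finite {j'. j < j' \<and> (i, j') \<in> young_diagram xs}"
    "finite {i'. i < i' \<and> (i', j) \<in> young_diagram xs}"
    by (simp_all add: finite_subset finite_young_diagram)
  then show ?thesis by (auto simp: hook_length_def)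
qed

lemma card_hooks_length_1:
  assumes "sorted_wrt (\<ge>) xs" "\<forall>x\<in>set xs. x > 0"
  shows "card {c \<in> young_diagram xs. hook_length xs c = 1} = card (set xs)"
proof -
  define C where "C = {c \<in> young_diagram xs. hook_length xs c = 1}"
  have C: "(i, j) \<in> C \<longleftrightarrow> i < length xs \<and> xs ! i = Suc j \<and>
      (\<forall>i'. i < i' \<longrightarrow> i' < length xs \<longrightarrow> xs ! i' \<le> j)" for i j
    unfolding C_def mem_Collect_eq hook_length_eq_1_iff
    by (auto simp: young_diagram_def not_less)
  have "bij_betw (\<lambda>c. xs ! fst c) C (set xs)"
  proof (rule bij_betwI')
    fix c d assume cd: "c \<in> C" "d \<in> C"
    obtain i j i' j' where [simp]: "c = (i, j)" "d = (i', j')" by fastforce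
    show "(xs ! fst c = xs ! fst d) = (c = d)"
      using cd by (cases i i' rule: linorder_cases) (auto simp: C)
  next
    fix c assume "c \<in> C"
    then show "xs ! fst c \<in> set xs" by (cases c) (metis C fst_conv nth_mem)
  next
    fix x assume x: "x \<in> set xs"
    let ?I = "{i. i < length xs \<and> xs ! i = x}"
    \<comment> \<open>Among the rows of length \<open>x\<close>, only the lowest ends in a corner:
      the row below it, if any, is strictly shorter.\<close>
    define i where "i = Max ?I"
    have "?I \<noteq> {}" using x by (auto simp: in_set_conv_nth)
    then have i: "i < length xs" "xs ! i = x"
      using Max_in[of ?I] by (auto simp: i_def)
    have "xs ! i' \<le> x - 1" if "i < i'" "i' < length xs" for i'
    proof -
      have "xs ! i' \<le> x"
        using assms(1) that i by (metis sorted_wrt_nth_less)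
      moreover have "xs ! i' \<noteq> x"
      proof
        assume "xs ! i' = x"
        then have "i' \<le> i" unfolding i_def using that by (intro Max_ge) auto
        with that show False by simp
      qed
      ultimately show ?thesis by simp
    qed
    then have "(i, x - 1) \<in> C"
      using i x assms(2) by (auto simp: C)
    then show "\<exists>c\<in>C. x = xs ! fst c"
      using i by force
  qed
  then show ?thesis unfolding C_def by (rule bij_betw_same_card)
qed

lemma regular_hooks_1_eq:
  "regular_hooks t 1 n =
    (\<Sum>m\<in>regular_parts t \<inter> {1..n}. card (mset_partitions (regular_parts t) (n - m)))"
proof -
  have "regular_hooks t 1 n = (\<Sum>xs\<in>regular_partitions t n. card (set_mset (mset xs)))"
    unfolding regular_hooks_def
    by (intro sum.cong refl)
      (simp add: card_hooks_length_1[unfolded One_nat_def] regular_partitions_def is_partition_def)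
  also have "\<dots> = (\<Sum>M\<in>mset_partitions (regular_parts t) n. card (set_mset M))"
    by (rule sum.reindex_bij_betw[OF bij_betw_mset_regular_partitions])
  also have "\<dots> = (\<Sum>m\<in>regular_parts t \<inter> {1..n}. card (mset_partitions (regular_parts t) (n - m)))"
    by (rule sum_card_set_mset_partitions) (simp add: regular_parts_def)
  finally show ?thesis .
qed

subsection \<open>Glaisher's identity\<close>

definition partition_fps :: "nat set \<Rightarrow> int fps" where
  "partition_fps A = Abs_fps (\<lambda>n. int (card (mset_partitions A n)))"

text \<open>A partition with parts in \<open>insert a A\<close> either avoids \<open>a\<close> or
  arises from a partition of \<open>n - a\<close> by adding one part \<open>a\<close>. The identity
  is this recurrence read coefficientwise.\<close>

lemma partition_fps_insert:
  assumes "0 \<notin> A" "a > 0" "a \<notin> A"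
  shows "partition_fps (insert a A) * (1 - fps_X ^ a) = partition_fps A"
proof (rule fps_ext)
  fix n
  let ?P = "mset_partitions (insert a A)" and ?Q = "{M \<in> mset_partitions (insert a A) n. a \<in># M}"
  have "?P n = mset_partitions A n \<union> ?Q" "mset_partitions A n \<inter> ?Q = {}"
    using assms by (auto simp: mset_partitions_def)
  moreover have "finite (?P n)" "finite (mset_partitions A n)"
    using assms by (simp_all add: finite_mset_partitions)
  ultimately have "card (?P n) = card (mset_partitions A n) + card ?Q"
    by (metis (no_types, lifting) card_Un_disjoint finite_Un)
  moreover have "card ?Q = (if n < a then 0 else card (?P (n - a)))"
  proof (cases "n < a")
    case True
    then have "?Q = {}" using sum_mset_ge_member[of a] by (fastforce simp: mset_partitions_def)
    with True show ?thesis by (simp only: card.empty if_True)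
  next
    case False
    then show ?thesis using card_mset_partitions_containing[of a "insert a A" n] by simp
  qed
  ultimately show "(partition_fps (insert a A) * (1 - fps_X ^ a)) $ n = partition_fps A $ n"
    by (simp add: right_diff_distrib fps_X_power_mult_right_nth partition_fps_def)
qed

text \<open>Euler's product formula, written without division and for finitely many parts, so that
  no infinite product occurs.\<close>

lemma partition_fps_mult_prod:
  assumes "finite A" "0 \<notin> A"
  shows "partition_fps A * (\<Prod>a\<in>A. 1 - fps_X ^ a) = 1"
  using assms
proof (induction A rule: finite_induct)
  case empty
  have "mset_partitions {} n = (if n = 0 then {{#}} else {})" for n
    by (auto simp: mset_partitions_def)
  then show ?case by (auto intro!: fps_ext simp: partition_fps_def)
next
  case (insert a A)
  have "partition_fps (insert a A) * (\<Prod>b\<in>insert a A. 1 - fps_X ^ b) =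
      partition_fps (insert a A) * (1 - fps_X ^ a) * (\<Prod>b\<in>A. 1 - fps_X ^ b)"
    using insert by (simp add: mult.assoc)
  also have "\<dots> = 1" using insert by (simp add: partition_fps_insert)
  finally show ?case .
qed

lemma fps_nth_mult_prod_high:
  fixes f :: "int fps"
  assumes "finite B" "\<And>b. b \<in> B \<Longrightarrow> n < b"
  shows "(f * (\<Prod>b\<in>B. 1 - fps_X ^ b)) $ n = f $ n"
  using assms
proof (induction B arbitrary: f rule: finite_induct)
  case (insert b B)
  have "(f * (\<Prod>b\<in>insert b B. 1 - fps_X ^ b)) $ n
      = (f * (1 - fps_X ^ b) * (\<Prod>b\<in>B. 1 - fps_X ^ b)) $ n"
    using insert by (simp add: mult.assoc)
  also have "\<dots> = (f * (1 - fps_X ^ b)) $ n" using insert by simp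
  also have "\<dots> = f $ n"
    using insert.prems by (simp add: right_diff_distrib fps_X_power_mult_right_nth)
  finally show ?case .
qed simp

lemma mset_partitions_restrict:
  "mset_partitions A n = mset_partitions (A \<inter> {..n}) n"
  using sum_mset_ge_member by (auto simp: mset_partitions_def)

text \<open>The right-hand side counts the partitions of \<open>n\<close> in which no part occurs \<open>t\<close> or more times.\<close>

lemma card_regular_eq_coeff:
  assumes "t > 0"
  shows "int (card (mset_partitions (regular_parts t) n)) =
    (\<Prod>m\<in>{1..n}. \<Sum>i<t. (fps_X ^ m) ^ i) $ n"
proof -
  \<comment> \<open>Truncated form of Glaisher's product. \<open>L\<close> is common to {1..n} and
    to the multiples t, 2t, ..., nt, so \<open>D L\<close> will cancel; \<open>H\<close> holds the
    multiples beyond \<open>n\<close>, which cannot affect coefficient \<open>n\<close>.\<close>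
  define D where "D S = (\<Prod>a\<in>S. 1 - fps_X ^ a :: int fps)" for S :: "nat set"
  define G where "G = (\<Prod>m\<in>{1..n}. \<Sum>i<t. (fps_X ^ m) ^ i :: int fps)"
  define R where "R = regular_parts t \<inter> {..n}"
  define L where "L = {m \<in> {1..n}. t dvd m}"
  define H where "H = (*) t ` {1..n} - {..n}"
  have fin: "finite R" "finite L" "finite H" by (auto simp: R_def L_def H_def)
  have "{1..n} = R \<union> L" "R \<inter> L = {}"
    by (auto simp: R_def L_def regular_parts_def)
  then have DRL: "D {1..n} = D R * D L"
    using fin unfolding D_def by (metis prod.union_disjoint)
  have "(*) t ` {1..n} = L \<union> H" "L \<inter> H = {}"
    using assms by (auto simp: L_def H_def image_iff elim!: dvdE)
      (metis One_nat_def Suc_le_eq le_trans mult_le_mono1 mult_1)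
  then have "D ((*) t ` {1..n}) = D L * D H"
    using fin unfolding D_def by (metis prod.union_disjoint)
  moreover have "D ((*) t ` {1..n}) = (\<Prod>m\<in>{1..n}. 1 - fps_X ^ (t * m))"
    unfolding D_def using assms by (subst prod.reindex) (auto simp: inj_on_def)
  \<comment> \<open>Each factor is a geometric sum in \<open>fps_X ^ m\<close>.\<close>
  moreover have "\<dots> = D {1..n} * G"
    unfolding D_def G_def prod.distrib[symmetric]
    by (intro prod.cong refl) (simp only: one_diff_power_eq[symmetric] power_mult[symmetric] mult.commute[of t])
  ultimately have DRLG: "D R * D L * G = D L * D H"
    by (simp only: DRL)
  have FR: "partition_fps R * D R = 1"
    unfolding D_def by (rule partition_fps_mult_prod) (use fin in \<open>auto simp: R_def regular_parts_def\<close>)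
  have "D L * G = (partition_fps R * D R) * (D L * G)"
    by (simp only: FR mult_1)
  also have "\<dots> = partition_fps R * (D R * D L * G)"
    by (simp only: mult.assoc)
  also have "\<dots> = D L * (partition_fps R * D H)"
    by (simp only: DRLG mult.left_commute)
  finally have "D L * G = D L * (partition_fps R * D H)" .
  moreover have "D L \<noteq> 0"
  proof -
    \<comment> \<open>The constant term is 1 because a > 0. Integer power series form an integral
      domain, so \<open>D L\<close> can then be cancelled.\<close>
    have "1 - fps_X ^ a \<noteq> (0 :: int fps)" if "a \<in> L" for a
    proof
      assume "1 - fps_X ^ a = (0 :: int fps)"
      then have "(1 - fps_X ^ a :: int fps) $ 0 = 0" by (simp only: fps_zero_nth)
      with that show False by (simp add: L_def)
    qed
    then show ?thesis unfolding D_def using fin by (simp add: prod_zero_iff)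
  qed
  ultimately have "G = partition_fps R * D H" by simp
  then have "G $ n = partition_fps R $ n"
    unfolding D_def using fps_nth_mult_prod_high[OF fin(3)] by (auto simp: H_def)
  then show ?thesis
    using mset_partitions_restrict[of "regular_parts t" n]
    by (simp add: G_def R_def partition_fps_def)
qed

text \<open>Coefficients of a product are sums of products of coefficients. Nonnegativity is part of
  the induction because multiplying inequalities requires it.\<close>

lemma fps_nth_prod_mono:
  fixes f g :: "'b \<Rightarrow> int fps"
  assumes "finite A" "\<And>a n. a \<in> A \<Longrightarrow> 0 \<le> f a $ n \<and> f a $ n \<le> g a $ n"
  shows "0 \<le> prod f A $ n \<and> prod f A $ n \<le> prod g A $ n"
  using assms
proof (induction A arbitrary: n rule: finite_induct)
  case (insert a A)
  have IH: "0 \<le> prod f A $ k" "prod f A $ k \<le> prod g A $ k" for k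
    using insert by auto
  have fg: "0 \<le> f a $ k" "f a $ k \<le> g a $ k" for k
    using insert.prems by auto
  show ?case
    using insert(1,2)
    by (auto simp: fps_mult_nth intro!: sum_nonneg sum_mono mult_mono mult_nonneg_nonneg IH fg
        intro: order_trans[OF IH(1) IH(2)] order_trans[OF fg(1) fg(2)])
qed auto

text \<open>Passing from \<open>t\<close> to \<open>t + 1\<close> adds the term with exponent
  \<open>m * t\<close> to each factor of the coefficient formula, that is, it allows each part one
  more repetition.\<close>

lemma card_regular_mono:
  assumes "t > 0"
  shows "card (mset_partitions (regular_parts t) n) \<le> card (mset_partitions (regular_parts (t + 1)) n)"
proof -
  have "0 \<le> ((fps_X :: int fps) ^ m) ^ i $ k" for m i k
    by (simp flip: power_mult)
  then have "(\<Prod>m\<in>{1..n}. \<Sum>i<t. (fps_X ^ m) ^ i :: int fps) $ n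
      \<le> (\<Prod>m\<in>{1..n}. \<Sum>i<t + 1. (fps_X ^ m) ^ i) $ n"
    by (intro fps_nth_prod_mono[THEN conjunct2]) (auto simp: fps_sum_nth intro!: sum_nonneg)
  then show ?thesis
    using assms card_regular_eq_coeff[of t n] card_regular_eq_coeff[of "t + 1" n] by simp
qed

subsection \<open>Comparison of the sums\<close>

text \<open>Both sides complete to the same sum over {1..n}, so it suffices to compare the omitted
  multiples in the opposite direction: those of \<open>t + 1\<close> are fewer, and the j-th one
  contributes at most as much as the j-th multiple of \<open>t\<close>.\<close>

lemma sum_nonmultiples_le:
  fixes p :: "nat \<Rightarrow> nat"
  assumes "mono p" "t > 0"
  shows "(\<Sum>m\<in>regular_parts t \<inter> {1..n}. p (n - m)) \<le>
    (\<Sum>m\<in>regular_parts (t + 1) \<inter> {1..n}. p (n - m))"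
proof -
  have split: "(\<Sum>m\<in>{1..n}. p (n - m)) =
      (\<Sum>m\<in>regular_parts d \<inter> {1..n}. p (n - m)) + (\<Sum>j\<in>{1..n div d}. p (n - d * j))"
    if "d > 0" for d
  proof -
    have "{1..n} = (regular_parts d \<inter> {1..n}) \<union> (*) d ` {1..n div d}"
      using that by (auto simp: regular_parts_def less_eq_div_iff_mult_less_eq mult.commute elim!: dvdE)
    moreover have "(regular_parts d \<inter> {1..n}) \<inter> (*) d ` {1..n div d} = {}"
      by (auto simp: regular_parts_def)
    ultimately have "(\<Sum>m\<in>{1..n}. p (n - m)) =
        (\<Sum>m\<in>regular_parts d \<inter> {1..n}. p (n - m)) + (\<Sum>m\<in>(*) d ` {1..n div d}. p (n - m))"
      by (metis (no_types, lifting) finite_Int finite_atLeastAtMost finite_imageI sum.union_disjoint)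
    also have "(\<Sum>m\<in>(*) d ` {1..n div d}. p (n - m)) = (\<Sum>j\<in>{1..n div d}. p (n - d * j))"
      using that by (subst sum.reindex) (auto simp: inj_on_def)
    finally show ?thesis .
  qed
  have "(\<Sum>j\<in>{1..n div (t + 1)}. p (n - (t + 1) * j)) \<le> (\<Sum>j\<in>{1..n div (t + 1)}. p (n - t * j))"
    by (intro sum_mono monoD[OF assms(1)]) simp
  also have "\<dots> \<le> (\<Sum>j\<in>{1..n div t}. p (n - t * j))"
    using assms div_le_mono2[of t "t + 1" n] by (intro sum_mono2) auto
  finally show ?thesis
    using split[of t] split[of "t + 1"] assms by simp
qed

theorem theorem1p1:
  fixes t :: nat
  assumes "t \<ge> 2"
  shows "\<forall>n::nat. regular_hooks (t + 1) 1 n \<ge> regular_hooks t 1 n"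
proof
  fix n
  define p where "p s k = card (mset_partitions (regular_parts s) k)" for s k
  have "mono (p t)"
    unfolding p_def using assms
    by (intro monoI card_mset_partitions_mono) (auto simp: regular_parts_def)
  \<comment> \<open>The two changes are made separately: first the range of \<open>m\<close> with
    \<open>p t\<close> fixed, then the counting function.\<close>
  then have "(\<Sum>m\<in>regular_parts t \<inter> {1..n}. p t (n - m)) \<le>
      (\<Sum>m\<in>regular_parts (t + 1) \<inter> {1..n}. p t (n - m))"
    using assms by (intro sum_nonmultiples_le) auto
  also have "\<dots> \<le> (\<Sum>m\<in>regular_parts (t + 1) \<inter> {1..n}. p (t + 1) (n - m))"
    unfolding p_def using assms by (intro sum_mono card_regular_mono) auto
  finally show "regular_hooks (t + 1) 1 n \<ge> regular_hooks t 1 n"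
    by (simp only: regular_hooks_1_eq p_def)
qed

end
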